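(* Let $X$ be a finite indecomposable quandle, $x_0\in X$, and $A$ an abelian group (written additively) with trivial $G_X$-action. Let $N_X=\bigsqcup_{i=0}^k\sigma_iN_0$ be a good decomposition of $N_X$ into $N_0$-cosets, and let $q\in H^2(X,A)$. Then there exist $a\in A$ and $g\in\mathrm{Hom}(N_0,A)$ such that the class $q$ is represented by the $2$-cocycle $$q_{x,y}=a+g\bigl(c(x\sigma_yx_0^{-1})\bigr),\qquad x,y\in X.$$
   Context: A rack is a non-empty set $X$ with a binary operation $\triangleright$ such that every map $\varphi_x\colon y\mapsto x\triangleright y$ is bijective and $x\triangleright(y\triangleright z)=(x\triangleright y)\triangleright(x\triangleright z)$ for all $x,y,z$. A quandle is a rack with $x\triangleright x=x$ for all $x$. It is indecomposable if the group $\langle\varphi_x:x\in X\rangle\le \mathbb S_X$ acts transitively on $X$. The enveloping group is $G_X=\langle x\in X: xy=(x\triangleright y)x\rangle$; it acts on $X$ with the generator $x$ acting by $\varphi_x$, and the action is written $g\triangleright y$. Put $N_X=[G_X,G_X]$ and let $N_0$ be the stabilizer of $x_0$ in $N_X$. A decomposition $N_X=\bigsqcup_{i=0}^k\sigma_iN_0$ into left $N_0$-cosets, with chosen representatives $\sigma_i\in N_X$, is good if: (1) $\sigma_0=1$; (2) for each $i$ there is $j$ with $x_0\triangleright\sigma_i=\sigma_j$, where $x_0\triangleright\sigma_i:=x_0\sigma_ix_0^{-1}$ in $G_X$; (3) for each $x\in X$ there is $j$ with $\sigma_j\triangleright x_0=x$. For $n\in N_X$, $\sigma(n)=\sigma_i$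 if $n\in\sigma_iN_0$, and $c(n)=\sigma(n)^{-1}n\in N_0$. For $y\in X$, $\sigma_y:=\sigma_j$ for the $j$ with $\sigma_j\triangleright x_0=y$. In the formula, $x$ and $x_0$ are regarded as elements of $G_X$; the element $x\sigma_yx_0^{-1}$ lies in $N_X$. Rack cohomology $H^2(X,A)$ (trivial coefficients): a 2-cocycle is a map $q\colon X\times X\to A$ with $q_{x\triangleright y,x\triangleright z}+q_{x,z}=q_{x,y\triangleright z}+q_{y,z}$ for all $x,y,z$; two cocycles $q,q'$ are equivalent if there is $\gamma\colon X\to A$ with $q'_{x,y}=q_{x,y}+\gamma(x\triangleright y)-\gamma(y)$ for all $x,y$; $H^2(X,A)$ is the group of equivalence classes. *)

theory Defs
  imports
    "HOL-Algebra.Generated_Groups"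
    "HOL-Algebra.Group_Action"
    "HOL-Algebra.Product_Groups"
    "HOL-Algebra.Ring"
    "HOL-Library.Disjoint_Sets"
begin

section \<open>Racks and quandles\<close>

locale rack =
  fixes X :: "'a set" and opr :: "'a \<Rightarrow> 'a \<Rightarrow> 'a" (infixr \<open>\<triangleright>\<close> 70)
  assumes nonempty: "X \<noteq> {}"
    and bij: "x \<in> X \<Longrightarrow> bij_betw (\<lambda>y. x \<triangleright> y) X X"
    and self_distrib: "\<lbrakk>x \<in> X; y \<in> X; z \<in> X\<rbrakk> \<Longrightarrow> x \<triangleright> (y \<triangleright> z) = (x \<triangleright> y) \<triangleright> (x \<triangleright> z)"

locale quandle = rack +
  assumes idem: "x \<in> X \<Longrightarrow> x \<triangleright> x = x"

definition rack_perm :: "'a set \<Rightarrow> ('a \<Rightarrow> 'a \<Rightarrow> 'a) \<Rightarrow> 'a \<Rightarrow> 'a \<Rightarrow> 'a" where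
  "rack_perm X opr x = (\<lambda>y\<in>X. opr x y)"

definition indecomposable :: "'a set \<Rightarrow> ('a \<Rightarrow> 'a \<Rightarrow> 'a) \<Rightarrow> bool" where
  "indecomposable X opr \<longleftrightarrow>
     (\<forall>y\<in>X. \<forall>z\<in>X. \<exists>f\<in>generate (BijGroup X) (rack_perm X opr ` X). f y = z)"


section \<open>The enveloping group\<close>

text \<open>The presented group is the monoid of words in letters \<open>(x, True)\<close>, standing for the
  generator \<open>x\<close>, and \<open>(x, False)\<close>, standing for its inverse, modulo the congruence generated by
  cancellation and by the defining relations.\<close>

definition env_words :: "'a set \<Rightarrow> ('a \<times> bool) list set" where
  "env_words X = lists (X \<times> UNIV)"

inductive_set env_cong ::
  "'a set \<Rightarrow> ('a \<Rightarrow> 'a \<Rightarrow> 'a) \<Rightarrow> (('a \<times> bool) list \<times> ('a \<times> bool) list) set"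
  for X :: "'a set" and opr :: "'a \<Rightarrow> 'a \<Rightarrow> 'a" where
  refl: "u \<in> env_words X \<Longrightarrow> (u, u) \<in> env_cong X opr"
| sym: "(u, v) \<in> env_cong X opr \<Longrightarrow> (v, u) \<in> env_cong X opr"
| trans: "\<lbrakk>(u, v) \<in> env_cong X opr; (v, w) \<in> env_cong X opr\<rbrakk> \<Longrightarrow> (u, w) \<in> env_cong X opr"
| append: "\<lbrakk>(u, u') \<in> env_cong X opr; (v, v') \<in> env_cong X opr\<rbrakk>
    \<Longrightarrow> (u @ v, u' @ v') \<in> env_cong X opr"
| cancel: "x \<in> X \<Longrightarrow> ([(x, b), (x, \<not> b)], []) \<in> env_cong X opr"
| relation: "\<lbrakk>x \<in> X; y \<in> X\<rbrakk>
    \<Longrightarrow> ([(x, True), (y, True)], [(opr x y, True), (x, True)]) \<in> env_cong X opr"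

definition env_group :: "'a set \<Rightarrow> ('a \<Rightarrow> 'a \<Rightarrow> 'a) \<Rightarrow> ('a \<times> bool) list set monoid" where
  "env_group X opr =
     \<lparr>carrier = env_words X // env_cong X opr,
      mult = (\<lambda>g h. \<Union>u\<in>g. \<Union>v\<in>h. env_cong X opr `` {u @ v}),
      one = env_cong X opr `` {[]}\<rparr>"

definition env_gen :: "'a set \<Rightarrow> ('a \<Rightarrow> 'a \<Rightarrow> 'a) \<Rightarrow> 'a \<Rightarrow> ('a \<times> bool) list set" where
  "env_gen X opr x = env_cong X opr `` {[(x, True)]}"

fun word_eval :: "('b, 'm) monoid_scheme \<Rightarrow> ('a \<Rightarrow> 'b) \<Rightarrow> ('a \<times> bool) list \<Rightarrow> 'b" where
  "word_eval H f [] = \<one>\<^bsub>H\<^esub>"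
| "word_eval H f ((x, b) # w) = (if b then f x else inv\<^bsub>H\<^esub> f x) \<otimes>\<^bsub>H\<^esub> word_eval H f w"

text \<open>The homomorphism out of the enveloping group induced by values on the generators; all words
  in the class \<open>g\<close> have the same value when \<open>f\<close> respects the defining relations.\<close>

definition env_lift :: "('b, 'm) monoid_scheme \<Rightarrow> ('a \<Rightarrow> 'b) \<Rightarrow> ('a \<times> bool) list set \<Rightarrow> 'b" where
  "env_lift H f g = the_elem (word_eval H f ` g)"

definition env_action ::
  "'a set \<Rightarrow> ('a \<Rightarrow> 'a \<Rightarrow> 'a) \<Rightarrow> ('a \<times> bool) list set \<Rightarrow> 'a \<Rightarrow> 'a" where
  "env_action X opr = env_lift (BijGroup X) (rack_perm X opr)"

definition env_comm :: "'a set \<Rightarrow> ('a \<Rightarrow> 'a \<Rightarrow> 'a) \<Rightarrow> ('a \<times> bool) list set set" where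
  "env_comm X opr = derived (env_group X opr) (carrier (env_group X opr))"

definition env_stab :: "'a set \<Rightarrow> ('a \<Rightarrow> 'a \<Rightarrow> 'a) \<Rightarrow> 'a \<Rightarrow> ('a \<times> bool) list set set" where
  "env_stab X opr x0 =
     stabilizer (env_group X opr\<lparr>carrier := env_comm X opr\<rparr>) (env_action X opr) x0"


subsection \<open>Well-definedness\<close>

context rack
begin

lemma closed [intro]: "\<lbrakk>x \<in> X; y \<in> X\<rbrakk> \<Longrightarrow> x \<triangleright> y \<in> X"
  using bij bij_betwE by blast

lemma env_cong_words:
  "(u, v) \<in> env_cong X (\<triangleright>) \<Longrightarrow> u \<in> env_words X \<and> v \<in> env_words X"
  by (induction rule: env_cong.induct) (auto simp: env_words_def)

lemma equiv_env_cong: "equiv (env_words X) (env_cong X (\<triangleright>))"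
  by (rule equivI)
    (auto simp: refl_on_def intro!: symI transI dest: env_cong_words
      intro: env_cong.refl env_cong.sym env_cong.trans)

lemma env_class_eq:
  "\<lbrakk>u \<in> env_words X; v \<in> env_words X\<rbrakk> \<Longrightarrow>
    env_cong X (\<triangleright>) `` {u} = env_cong X (\<triangleright>) `` {v} \<longleftrightarrow> (u, v) \<in> env_cong X (\<triangleright>)"
  by (rule eq_equiv_class_iff[OF equiv_env_cong])

lemma env_mult_class:
  assumes "u \<in> env_words X" "v \<in> env_words X"
  shows "env_cong X (\<triangleright>) `` {u} \<otimes>\<^bsub>env_group X (\<triangleright>)\<^esub> env_cong X (\<triangleright>) `` {v}
         = env_cong X (\<triangleright>) `` {u @ v}"
proof -
  have "congruent2 (env_cong X (\<triangleright>)) (env_cong X (\<triangleright>)) (\<lambda>u v. env_cong X (\<triangleright>) `` {u @ v})"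
    by (auto simp: congruent2_def intro!: equiv_class_eq[OF equiv_env_cong] env_cong.append)
  then show ?thesis
    using assms by (simp add: env_group_def UN_equiv_class2[OF equiv_env_cong equiv_env_cong])
qed

lemma env_carrier_cases:
  assumes "g \<in> carrier (env_group X (\<triangleright>))"
  obtains u where "u \<in> env_words X" "g = env_cong X (\<triangleright>) `` {u}"
  using assms by (auto simp: env_group_def elim!: quotientE)

lemma env_class_carrier [intro]:
  "u \<in> env_words X \<Longrightarrow> env_cong X (\<triangleright>) `` {u} \<in> carrier (env_group X (\<triangleright>))"
  by (simp add: env_group_def quotientI)

lemma env_words_append [simp]:
  "u @ v \<in> env_words X \<longleftrightarrow> u \<in> env_words X \<and> v \<in> env_words X"
  by (auto simp: env_words_def)

lemma env_one: "\<one>\<^bsub>env_group X (\<triangleright>)\<^esub> = env_cong X (\<triangleright>) `` {[]}"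
  by (simp add: env_group_def)

lemma nil_env_words [simp]: "[] \<in> env_words X"
  by (simp add: env_words_def)

lemma env_word_inverse:
  "u \<in> env_words X \<Longrightarrow> \<exists>v\<in>env_words X. (v @ u, []) \<in> env_cong X (\<triangleright>)"
proof (induction u)
  case Nil
  then show ?case by (auto intro!: bexI[of _ "[]"] env_cong.refl)
next
  case (Cons l u)
  obtain x b where l: "l = (x, b)" by (cases l)
  have x: "x \<in> X" and u: "u \<in> env_words X"
    using Cons.prems by (auto simp: l env_words_def)
  obtain v where v: "v \<in> env_words X" "(v @ u, []) \<in> env_cong X (\<triangleright>)"
    using Cons.IH u by blast
  have "([(x, \<not> b), (x, \<not> \<not> b)] @ u, [] @ u) \<in> env_cong X (\<triangleright>)"
    by (intro env_cong.append env_cong.cancel env_cong.refl x u)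
  then have "(v @ [(x, \<not> b), (x, b)] @ u, v @ u) \<in> env_cong X (\<triangleright>)"
    using env_cong.append[OF env_cong.refl[OF v(1)]] by fastforce
  then have "((v @ [(x, \<not> b)]) @ (l # u), []) \<in> env_cong X (\<triangleright>)"
    using env_cong.trans v(2) by (fastforce simp: l)
  moreover have "v @ [(x, \<not> b)] \<in> env_words X"
    using v(1) x by (simp add: env_words_def)
  ultimately show ?case by blast
qed

theorem group_env_group: "group (env_group X (\<triangleright>))"
proof (rule groupI)
  fix g assume "g \<in> carrier (env_group X (\<triangleright>))"
  then obtain u where u: "u \<in> env_words X" "g = env_cong X (\<triangleright>) `` {u}"
    by (rule env_carrier_cases)
  obtain v where "v \<in> env_words X" "(v @ u, []) \<in> env_cong X (\<triangleright>)"
    using env_word_inverse u(1) by blast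
  then show "\<exists>h\<in>carrier (env_group X (\<triangleright>)). h \<otimes>\<^bsub>env_group X (\<triangleright>)\<^esub> g = \<one>\<^bsub>env_group X (\<triangleright>)\<^esub>"
    using u by (intro bexI[of _ "env_cong X (\<triangleright>) `` {v}"])
      (auto simp: env_mult_class env_one env_class_eq)
qed (auto elim!: env_carrier_cases intro!: env_class_carrier simp: env_mult_class env_one)

lemma env_gen_carrier: "x \<in> X \<Longrightarrow> env_gen X (\<triangleright>) x \<in> carrier (env_group X (\<triangleright>))"
  unfolding env_gen_def by (rule env_class_carrier) (simp add: env_words_def)

lemma env_gen_relation:
  assumes "x \<in> X" "y \<in> X"
  shows "env_gen X (\<triangleright>) x \<otimes>\<^bsub>env_group X (\<triangleright>)\<^esub> env_gen X (\<triangleright>) y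
       = env_gen X (\<triangleright>) (x \<triangleright> y) \<otimes>\<^bsub>env_group X (\<triangleright>)\<^esub> env_gen X (\<triangleright>) x"
proof -
  have w: "[(z, True)] \<in> env_words X" if "z \<in> X" for z
    using that by (simp add: env_words_def)
  show ?thesis
    unfolding env_gen_def
    using equiv_class_eq[OF equiv_env_cong env_cong.relation[OF assms]]
    by (simp add: env_mult_class w assms closed)
qed

context
  fixes H :: "('b, 'm) monoid_scheme" and f :: "'a \<Rightarrow> 'b"
  assumes H: "group H"
    and f: "f \<in> X \<rightarrow> carrier H"
    and f_rel: "\<And>x y. \<lbrakk>x \<in> X; y \<in> X\<rbrakk> \<Longrightarrow> f x \<otimes>\<^bsub>H\<^esub> f y = f (x \<triangleright> y) \<otimes>\<^bsub>H\<^esub> f x"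
begin

interpretation H: group H by (rule H)

lemma f_closed: "x \<in> X \<Longrightarrow> f x \<in> carrier H"
  using f by blast

lemma word_eval_closed: "u \<in> env_words X \<Longrightarrow> word_eval H f u \<in> carrier H"
  by (induction u) (auto simp: env_words_def f_closed)

lemma word_eval_append:
  "\<lbrakk>u \<in> env_words X; v \<in> env_words X\<rbrakk>
    \<Longrightarrow> word_eval H f (u @ v) = word_eval H f u \<otimes>\<^bsub>H\<^esub> word_eval H f v"
proof (induction u)
  case Nil
  then show ?case by (simp add: word_eval_closed)
next
  case (Cons l u)
  obtain x b where l: "l = (x, b)" by (cases l)
  have "x \<in> X" "u \<in> env_words X"
    using Cons.prems by (auto simp: l env_words_def)
  with Cons show ?case by (simp add: l H.m_assoc word_eval_closed f_closed)
qed

lemma word_eval_cong: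
  "(u, v) \<in> env_cong X (\<triangleright>) \<Longrightarrow> word_eval H f u = word_eval H f v"
proof (induction rule: env_cong.induct)
  case (append u u' v v')
  then show ?case
    using env_cong_words[OF append.hyps(1)] env_cong_words[OF append.hyps(2)]
    by (simp add: word_eval_append)
next
  case (cancel x b)
  then show ?case by (simp add: f_closed)
next
  case (relation x y)
  then show ?case using f_rel[of x y] by (simp add: f_closed closed)
qed auto

lemma env_lift_class:
  assumes "u \<in> env_words X"
  shows "env_lift H f (env_cong X (\<triangleright>) `` {u}) = word_eval H f u"
proof -
  have "word_eval H f ` (env_cong X (\<triangleright>) `` {u}) = {word_eval H f u}"
    using assms env_cong.refl by (fastforce dest: word_eval_cong)
  then show ?thesis by (simp add: env_lift_def)
qed

theorem env_lift_hom: "env_lift H f \<in> hom (env_group X (\<triangleright>)) H"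
  by (rule homI)
    (auto elim!: env_carrier_cases
      simp: env_mult_class env_lift_class word_eval_closed word_eval_append)

theorem env_lift_gen: "x \<in> X \<Longrightarrow> env_lift H f (env_gen X (\<triangleright>) x) = f x"
  unfolding env_gen_def by (subst env_lift_class) (auto simp: env_words_def f_closed)

end

lemma rack_perm_Bij: "x \<in> X \<Longrightarrow> rack_perm X (\<triangleright>) x \<in> carrier (BijGroup X)"
  using bij by (auto simp: rack_perm_def BijGroup_def Bij_def cong: bij_betw_cong)

lemma rack_perm_relation:
  assumes "x \<in> X" "y \<in> X"
  shows "rack_perm X (\<triangleright>) x \<otimes>\<^bsub>BijGroup X\<^esub> rack_perm X (\<triangleright>) y
       = rack_perm X (\<triangleright>) (x \<triangleright> y) \<otimes>\<^bsub>BijGroup X\<^esub> rack_perm X (\<triangleright>) x"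
  using assms rack_perm_Bij[of x] rack_perm_Bij[of y] rack_perm_Bij[of "x \<triangleright> y"]
  by (auto simp: BijGroup_def compose_def rack_perm_def closed simp flip: self_distrib
      intro!: restrict_ext)

theorem env_group_action: "group_action (env_group X (\<triangleright>)) X (env_action X (\<triangleright>))"
  unfolding group_action_def group_hom_def group_hom_axioms_def env_action_def
  by (intro conjI group_env_group group_BijGroup env_lift_hom funcsetI rack_perm_Bij
      rack_perm_relation)

theorem env_action_gen:
  assumes "x \<in> X" "y \<in> X"
  shows "env_action X (\<triangleright>) (env_gen X (\<triangleright>) x) y = x \<triangleright> y"
proof -
  have "env_action X (\<triangleright>) (env_gen X (\<triangleright>) x) = rack_perm X (\<triangleright>) x"
    unfolding env_action_def
    by (intro env_lift_gen group_BijGroup funcsetI rack_perm_Bij rack_perm_relation assms)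
  then show ?thesis using assms by (simp add: rack_perm_def)
qed

end


section \<open>Good decompositions\<close>

definition good_decomposition ::
  "'a set \<Rightarrow> ('a \<Rightarrow> 'a \<Rightarrow> 'a) \<Rightarrow> 'a \<Rightarrow> nat \<Rightarrow> (nat \<Rightarrow> ('a \<times> bool) list set) \<Rightarrow> bool" where
  "good_decomposition X opr x0 k \<sigma> \<longleftrightarrow>
     (let G = env_group X opr; N0 = env_stab X opr x0; x0' = env_gen X opr x0 in
       \<sigma> ` {..k} \<subseteq> env_comm X opr
       \<and> env_comm X opr = (\<Union>i\<le>k. \<sigma> i <#\<^bsub>G\<^esub> N0)
       \<and> disjoint_family_on (\<lambda>i. \<sigma> i <#\<^bsub>G\<^esub> N0) {..k}
       \<and> \<sigma> 0 = \<one>\<^bsub>G\<^esub>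
       \<and> (\<forall>i\<le>k. \<exists>j\<le>k. x0' \<otimes>\<^bsub>G\<^esub> \<sigma> i \<otimes>\<^bsub>G\<^esub> inv\<^bsub>G\<^esub> x0' = \<sigma> j)
       \<and> (\<forall>x\<in>X. \<exists>j\<le>k. env_action X opr (\<sigma> j) x0 = x))"

definition coset_rep ::
  "'a set \<Rightarrow> ('a \<Rightarrow> 'a \<Rightarrow> 'a) \<Rightarrow> 'a \<Rightarrow> nat \<Rightarrow> (nat \<Rightarrow> ('a \<times> bool) list set)
    \<Rightarrow> ('a \<times> bool) list set \<Rightarrow> ('a \<times> bool) list set" where
  "coset_rep X opr x0 k \<sigma> n =
     (THE s. \<exists>i\<le>k. s = \<sigma> i \<and> n \<in> \<sigma> i <#\<^bsub>env_group X opr\<^esub> env_stab X opr x0)"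

definition coset_part ::
  "'a set \<Rightarrow> ('a \<Rightarrow> 'a \<Rightarrow> 'a) \<Rightarrow> 'a \<Rightarrow> nat \<Rightarrow> (nat \<Rightarrow> ('a \<times> bool) list set)
    \<Rightarrow> ('a \<times> bool) list set \<Rightarrow> ('a \<times> bool) list set" where
  "coset_part X opr x0 k \<sigma> n =
     inv\<^bsub>env_group X opr\<^esub> (coset_rep X opr x0 k \<sigma> n) \<otimes>\<^bsub>env_group X opr\<^esub> n"

definition point_rep ::
  "'a set \<Rightarrow> ('a \<Rightarrow> 'a \<Rightarrow> 'a) \<Rightarrow> 'a \<Rightarrow> nat \<Rightarrow> (nat \<Rightarrow> ('a \<times> bool) list set)
    \<Rightarrow> 'a \<Rightarrow> ('a \<times> bool) list set" where
  "point_rep X opr x0 k \<sigma> y = (THE s. \<exists>j\<le>k. s = \<sigma> j \<and> env_action X opr (\<sigma> j) x0 = y)"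

context rack
begin

lemma subgroup_env_comm: "subgroup (env_comm X (\<triangleright>)) (env_group X (\<triangleright>))"
  unfolding env_comm_def by (rule group.derived_is_subgroup[OF group_env_group]) simp

lemma subgroup_env_stab:
  assumes "x0 \<in> X"
  shows "subgroup (env_stab X (\<triangleright>) x0) (env_group X (\<triangleright>))"
proof -
  have "env_stab X (\<triangleright>) x0
      = env_comm X (\<triangleright>) \<inter> stabilizer (env_group X (\<triangleright>)) (env_action X (\<triangleright>)) x0"
    using subgroup.subset[OF subgroup_env_comm] by (auto simp: env_stab_def stabilizer_def)
  then show ?thesis
    using group.subgroups_Inter_pair[OF group_env_group subgroup_env_comm
        group_action.stabilizer_subgroup[OF env_group_action assms]] by simp
qed

lemma coset_rep_eqI:
  assumes "good_decomposition X (\<triangleright>) x0 k \<sigma>" and "i \<le> k"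
    and "n \<in> \<sigma> i <#\<^bsub>env_group X (\<triangleright>)\<^esub> env_stab X (\<triangleright>) x0"
  shows "coset_rep X (\<triangleright>) x0 k \<sigma> n = \<sigma> i"
  unfolding coset_rep_def
proof (rule the_equality)
  fix s
  assume "\<exists>j\<le>k. s = \<sigma> j \<and> n \<in> \<sigma> j <#\<^bsub>env_group X (\<triangleright>)\<^esub> env_stab X (\<triangleright>) x0"
  then obtain j where j: "j \<le> k" "s = \<sigma> j"
    "n \<in> \<sigma> j <#\<^bsub>env_group X (\<triangleright>)\<^esub> env_stab X (\<triangleright>) x0" by blast
  have "disjoint_family_on (\<lambda>i. \<sigma> i <#\<^bsub>env_group X (\<triangleright>)\<^esub> env_stab X (\<triangleright>) x0) {..k}"
    using assms(1) by (simp add: good_decomposition_def Let_def)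
  then have "i = j"
    using assms(2,3) j(1,3) by (auto simp: disjoint_family_on_def)
  then show "s = \<sigma> i" using j(2) by simp
qed (use assms(2,3) in blast)

lemma point_rep_eqI:
  assumes good: "good_decomposition X (\<triangleright>) x0 k \<sigma>" and x0: "x0 \<in> X"
    and j: "j \<le> k" "env_action X (\<triangleright>) (\<sigma> j) x0 = y"
  shows "point_rep X (\<triangleright>) x0 k \<sigma> y = \<sigma> j"
  unfolding point_rep_def
proof (rule the_equality)
  let ?G = "env_group X (\<triangleright>)" and ?N0 = "env_stab X (\<triangleright>) x0"
  let ?act = "env_action X (\<triangleright>)"
  interpret G: group ?G by (rule group_env_group)
  interpret act: group_action ?G X ?act by (rule env_group_action)
  fix s assume "\<exists>i\<le>k. s = \<sigma> i \<and> ?act (\<sigma> i) x0 = y"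
  then obtain i where i: "i \<le> k" "s = \<sigma> i" "?act (\<sigma> i) x0 = y" by blast
  have comm: "\<sigma> i \<in> env_comm X (\<triangleright>)" "\<sigma> j \<in> env_comm X (\<triangleright>)"
    using good i(1) j(1) by (auto simp: good_decomposition_def Let_def)
  then have carr: "\<sigma> i \<in> carrier ?G" "\<sigma> j \<in> carrier ?G"
    using subgroup.mem_carrier[OF subgroup_env_comm] by blast+
  let ?n = "inv\<^bsub>?G\<^esub> \<sigma> i \<otimes>\<^bsub>?G\<^esub> \<sigma> j"
  have "?act ?n x0 = ?act (inv\<^bsub>?G\<^esub> \<sigma> i) (?act (\<sigma> j) x0)"
    by (rule act.composition_rule) (use x0 carr in auto)
  also have "\<dots> = x0"
    using act.orbit_sym_aux[OF carr(1) x0] i(3) j(2) by simp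
  finally have "?n \<in> ?N0"
    using comm subgroup.m_closed[OF subgroup_env_comm] subgroup.m_inv_closed[OF subgroup_env_comm]
    by (simp add: env_stab_def stabilizer_def)
  moreover have "\<sigma> j = \<sigma> i \<otimes>\<^bsub>?G\<^esub> ?n"
    using carr by (simp add: G.inv_solve_left' flip: G.m_assoc)
  ultimately have "\<sigma> j \<in> \<sigma> i <#\<^bsub>?G\<^esub> ?N0"
    unfolding l_coset_def by blast
  moreover have "\<sigma> j \<in> \<sigma> j <#\<^bsub>?G\<^esub> ?N0"
    using carr subgroup.one_closed[OF subgroup_env_stab[OF x0]]
    by (force simp: l_coset_def)
  ultimately show "s = \<sigma> j"
    using coset_rep_eqI[OF good] i(1,2) j(1) by metis
qed (use j in blast)

end


section \<open>Second rack cohomology with trivial coefficients\<close>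

text \<open>The coefficient group is the additive group of the record \<open>A\<close>; its multiplicative
  components are never used. Cochains are extensional functions on \<open>X \<times> X\<close>.\<close>

definition rack_Z2 ::
  "'a set \<Rightarrow> ('a \<Rightarrow> 'a \<Rightarrow> 'a) \<Rightarrow> ('b, 'm) ring_scheme \<Rightarrow> ('a \<times> 'a \<Rightarrow> 'b) set" where
  "rack_Z2 X opr A =
     {q \<in> X \<times> X \<rightarrow>\<^sub>E carrier A. \<forall>x\<in>X. \<forall>y\<in>X. \<forall>z\<in>X.
        q (opr x y, opr x z) \<oplus>\<^bsub>A\<^esub> q (x, z) = q (x, opr y z) \<oplus>\<^bsub>A\<^esub> q (y, z)}"

definition rack_cocycle_group ::
  "'a set \<Rightarrow> ('a \<Rightarrow> 'a \<Rightarrow> 'a) \<Rightarrow> ('b, 'm) ring_scheme \<Rightarrow> ('a \<times> 'a \<Rightarrow> 'b) monoid" where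
  "rack_cocycle_group X opr A =
     product_group (X \<times> X) (\<lambda>_. add_monoid A)\<lparr>carrier := rack_Z2 X opr A\<rparr>"

definition rack_cohomologous ::
  "'a set \<Rightarrow> ('a \<Rightarrow> 'a \<Rightarrow> 'a) \<Rightarrow> ('b, 'm) ring_scheme
    \<Rightarrow> (('a \<times> 'a \<Rightarrow> 'b) \<times> ('a \<times> 'a \<Rightarrow> 'b)) set" where
  "rack_cohomologous X opr A =
     {(q, q'). q \<in> rack_Z2 X opr A \<and> q' \<in> rack_Z2 X opr A \<and>
        (\<exists>\<gamma>\<in>X \<rightarrow> carrier A. \<forall>x\<in>X. \<forall>y\<in>X.
           q' (x, y) = q (x, y) \<oplus>\<^bsub>A\<^esub> \<gamma> (opr x y) \<ominus>\<^bsub>A\<^esub> \<gamma> y)}"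

definition rack_H2 ::
  "'a set \<Rightarrow> ('a \<Rightarrow> 'a \<Rightarrow> 'a) \<Rightarrow> ('b, 'm) ring_scheme \<Rightarrow> ('a \<times> 'a \<Rightarrow> 'b) set monoid" where
  "rack_H2 X opr A =
     \<lparr>carrier = rack_Z2 X opr A // rack_cohomologous X opr A,
      mult = (<#>\<^bsub>rack_cocycle_group X opr A\<^esub>),
      one = rack_cohomologous X opr A `` {\<one>\<^bsub>rack_cocycle_group X opr A\<^esub>}\<rparr>"

lemma rack_cocycle_group_simps:
  "carrier (rack_cocycle_group X opr A) = rack_Z2 X opr A"
  "p \<otimes>\<^bsub>rack_cocycle_group X opr A\<^esub> q = (\<lambda>i\<in>X \<times> X. p i \<oplus>\<^bsub>A\<^esub> q i)"
  "\<one>\<^bsub>rack_cocycle_group X opr A\<^esub> = (\<lambda>i\<in>X \<times> X. \<zero>\<^bsub>A\<^esub>)"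
  by (simp_all add: rack_cocycle_group_def)

locale rack_coefficients = rack X opr + A: abelian_group A
  for X :: "'a set" and opr :: "'a \<Rightarrow> 'a \<Rightarrow> 'a" (infixr \<open>\<triangleright>\<close> 70)
    and A :: "('b, 'm) ring_scheme" (structure)
begin

lemma rack_Z2_closed: "\<lbrakk>q \<in> rack_Z2 X (\<triangleright>) A; x \<in> X; y \<in> X\<rbrakk> \<Longrightarrow> q (x, y) \<in> carrier A"
  by (auto simp: rack_Z2_def)

lemma rack_Z2_add:
  assumes p: "p \<in> rack_Z2 X (\<triangleright>) A" and q: "q \<in> rack_Z2 X (\<triangleright>) A"
  shows "(\<lambda>i\<in>X \<times> X. p i \<oplus> q i) \<in> rack_Z2 X (\<triangleright>) A"
proof -
  have "(p (x \<triangleright> y, x \<triangleright> z) \<oplus> q (x \<triangleright> y, x \<triangleright> z)) \<oplus> (p (x, z) \<oplus> q (x, z))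
      = (p (x, y \<triangleright> z) \<oplus> q (x, y \<triangleright> z)) \<oplus> (p (y, z) \<oplus> q (y, z))"
    if xyz: "x \<in> X" "y \<in> X" "z \<in> X" for x y z
  proof -
    have "p (x \<triangleright> y, x \<triangleright> z) \<oplus> p (x, z) = p (x, y \<triangleright> z) \<oplus> p (y, z)"
      "q (x \<triangleright> y, x \<triangleright> z) \<oplus> q (x, z) = q (x, y \<triangleright> z) \<oplus> q (y, z)"
      using p q xyz by (auto simp: rack_Z2_def)
    then have "(p (x \<triangleright> y, x \<triangleright> z) \<oplus> p (x, z)) \<oplus> (q (x \<triangleright> y, x \<triangleright> z) \<oplus> q (x, z))
        = (p (x, y \<triangleright> z) \<oplus> p (y, z)) \<oplus> (q (x, y \<triangleright> z) \<oplus> q (y, z))" by simp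
    then show ?thesis
      using xyz rack_Z2_closed[OF p] rack_Z2_closed[OF q] by (simp add: A.a_ac closed)
  qed
  then show ?thesis
    using rack_Z2_closed[OF p] rack_Z2_closed[OF q] by (auto simp: rack_Z2_def closed)
qed

lemma rack_Z2_uminus:
  assumes p: "p \<in> rack_Z2 X (\<triangleright>) A"
  shows "(\<lambda>i\<in>X \<times> X. \<ominus> p i) \<in> rack_Z2 X (\<triangleright>) A"
proof -
  have "\<ominus> p (x \<triangleright> y, x \<triangleright> z) \<oplus> \<ominus> p (x, z) = \<ominus> p (x, y \<triangleright> z) \<oplus> \<ominus> p (y, z)"
    if xyz: "x \<in> X" "y \<in> X" "z \<in> X" for x y z
  proof -
    have "p (x \<triangleright> y, x \<triangleright> z) \<oplus> p (x, z) = p (x, y \<triangleright> z) \<oplus> p (y, z)"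
      using p xyz by (auto simp: rack_Z2_def)
    then show ?thesis
      using xyz rack_Z2_closed[OF p] by (simp add: closed flip: A.minus_add)
  qed
  then show ?thesis
    using rack_Z2_closed[OF p] by (auto simp: rack_Z2_def closed)
qed

lemma rack_Z2_zero: "(\<lambda>i\<in>X \<times> X. \<zero>) \<in> rack_Z2 X (\<triangleright>) A"
  by (auto simp: rack_Z2_def closed)

lemma comm_group_rack_cocycle_group: "comm_group (rack_cocycle_group X (\<triangleright>) A)"
proof (rule comm_groupI; unfold rack_cocycle_group_simps)
  fix p q r
  assume p: "p \<in> rack_Z2 X (\<triangleright>) A" and q: "q \<in> rack_Z2 X (\<triangleright>) A" and r: "r \<in> rack_Z2 X (\<triangleright>) A"
  show "(\<lambda>i\<in>X \<times> X. (\<lambda>i\<in>X \<times> X. p i \<oplus> q i) i \<oplus> r i)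
      = (\<lambda>i\<in>X \<times> X. p i \<oplus> (\<lambda>i\<in>X \<times> X. q i \<oplus> r i) i)"
    using rack_Z2_closed[OF p] rack_Z2_closed[OF q] rack_Z2_closed[OF r]
    by (auto simp: A.a_assoc intro!: restrict_ext)
next
  fix p q
  assume p: "p \<in> rack_Z2 X (\<triangleright>) A" and q: "q \<in> rack_Z2 X (\<triangleright>) A"
  show "(\<lambda>i\<in>X \<times> X. p i \<oplus> q i) = (\<lambda>i\<in>X \<times> X. q i \<oplus> p i)"
    using rack_Z2_closed[OF p] rack_Z2_closed[OF q]
    by (auto simp: A.a_comm intro!: restrict_ext)
next
  fix p assume p: "p \<in> rack_Z2 X (\<triangleright>) A"
  then have ext: "p \<in> extensional (X \<times> X)"
    by (auto simp: rack_Z2_def PiE_def)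
  show "(\<lambda>i\<in>X \<times> X. (\<lambda>i\<in>X \<times> X. \<zero>) i \<oplus> p i) = p"
    by (rule extensionalityI[OF _ ext]) (use rack_Z2_closed[OF p] in auto)
  show "\<exists>q\<in>rack_Z2 X (\<triangleright>) A. (\<lambda>i\<in>X \<times> X. q i \<oplus> p i) = (\<lambda>i\<in>X \<times> X. \<zero>)"
    using rack_Z2_closed[OF p]
    by (intro bexI[OF _ rack_Z2_uminus[OF p]] restrict_ext) (auto simp: A.l_neg)
qed (use rack_Z2_add rack_Z2_zero in auto)

definition rack_B2 :: "('a \<times> 'a \<Rightarrow> 'b) set" where
  "rack_B2 = rack_cohomologous X (\<triangleright>) A `` {\<lambda>i\<in>X \<times> X. \<zero>}"

lemma rack_B2_iff:
  "b \<in> rack_B2 \<longleftrightarrow> b \<in> rack_Z2 X (\<triangleright>) A \<and>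
     (\<exists>\<gamma>\<in>X \<rightarrow> carrier A. \<forall>x\<in>X. \<forall>y\<in>X. b (x, y) = \<gamma> (x \<triangleright> y) \<ominus> \<gamma> y)"
proof -
  have "\<zero> \<oplus> \<gamma> (x \<triangleright> y) \<ominus> \<gamma> y = \<gamma> (x \<triangleright> y) \<ominus> \<gamma> y"
    if "\<gamma> \<in> X \<rightarrow> carrier A" "x \<in> X" "y \<in> X" for \<gamma> x y
    using that closed[of x y] by (simp add: Pi_iff)
  then show ?thesis
    using rack_Z2_zero by (fastforce simp: rack_B2_def rack_cohomologous_def)
qed

lemma subgroup_rack_B2: "subgroup rack_B2 (rack_cocycle_group X (\<triangleright>) A)"
proof -
  interpret Z: comm_group "rack_cocycle_group X (\<triangleright>) A" by (rule comm_group_rack_cocycle_group)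
  have inv: "inv\<^bsub>rack_cocycle_group X (\<triangleright>) A\<^esub> p = (\<lambda>i\<in>X \<times> X. \<ominus> p i)"
    if "p \<in> rack_Z2 X (\<triangleright>) A" for p
    using that rack_Z2_closed[OF that] rack_Z2_uminus[OF that]
    by (intro Z.inv_equality) (auto simp: rack_cocycle_group_simps A.l_neg intro!: restrict_ext)
  show ?thesis
  proof (rule Z.subgroupI)
    show "rack_B2 \<subseteq> carrier (rack_cocycle_group X (\<triangleright>) A)"
      by (auto simp: rack_B2_iff rack_cocycle_group_simps)
    have "\<ominus> \<zero> = \<zero>"
      by (rule A.minus_equality) auto
    have "(\<lambda>i\<in>X \<times> X. \<zero>) \<in> rack_B2"
      unfolding rack_B2_iff using rack_Z2_zero
      by (auto intro!: bexI[of _ "\<lambda>_. \<zero>"] simp: A.minus_eq \<open>\<ominus> \<zero> = \<zero>\<close>)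
    then show "rack_B2 \<noteq> {}" by blast
  next
    fix p assume "p \<in> rack_B2"
    then obtain \<gamma> where p: "p \<in> rack_Z2 X (\<triangleright>) A" and \<gamma>: "\<gamma> \<in> X \<rightarrow> carrier A"
      "\<forall>x\<in>X. \<forall>y\<in>X. p (x, y) = \<gamma> (x \<triangleright> y) \<ominus> \<gamma> y"
      unfolding rack_B2_iff by blast
    have "\<gamma> x \<in> carrier A" if "x \<in> X" for x using \<gamma>(1) that by blast
    then have "(\<lambda>i\<in>X \<times> X. \<ominus> p i) \<in> rack_B2"
      unfolding rack_B2_iff using rack_Z2_uminus[OF p] \<gamma>
      by (auto intro!: bexI[of _ "\<lambda>x. \<ominus> \<gamma> x"] simp: A.minus_eq A.minus_add closed)
    then show "inv\<^bsub>rack_cocycle_group X (\<triangleright>) A\<^esub> p \<in> rack_B2" using inv p by simp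
  next
    fix p q assume "p \<in> rack_B2" "q \<in> rack_B2"
    then obtain \<gamma> \<delta> where p: "p \<in> rack_Z2 X (\<triangleright>) A" and \<gamma>: "\<gamma> \<in> X \<rightarrow> carrier A"
      "\<forall>x\<in>X. \<forall>y\<in>X. p (x, y) = \<gamma> (x \<triangleright> y) \<ominus> \<gamma> y"
      and q: "q \<in> rack_Z2 X (\<triangleright>) A" and \<delta>: "\<delta> \<in> X \<rightarrow> carrier A"
      "\<forall>x\<in>X. \<forall>y\<in>X. q (x, y) = \<delta> (x \<triangleright> y) \<ominus> \<delta> y"
      unfolding rack_B2_iff by blast
    have "\<gamma> x \<in> carrier A" "\<delta> x \<in> carrier A" if "x \<in> X" for x using \<gamma>(1) \<delta>(1) that by blast+
    then show "p \<otimes>\<^bsub>rack_cocycle_group X (\<triangleright>) A\<^esub> q \<in> rack_B2"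
      unfolding rack_B2_iff rack_cocycle_group_simps using rack_Z2_add[OF p q] \<gamma> \<delta>
      by (auto intro!: bexI[of _ "\<lambda>x. \<gamma> x \<oplus> \<delta> x"] simp: A.minus_eq A.minus_add A.a_ac closed)
  qed
qed

lemma rack_cohomologous_coset:
  assumes q: "q \<in> rack_Z2 X (\<triangleright>) A"
  shows "rack_cohomologous X (\<triangleright>) A `` {q} = rack_B2 #>\<^bsub>rack_cocycle_group X (\<triangleright>) A\<^esub> q"
proof (intro equalityI subsetI)
  fix q' assume "q' \<in> rack_cohomologous X (\<triangleright>) A `` {q}"
  then obtain \<gamma> where q': "q' \<in> rack_Z2 X (\<triangleright>) A" and \<gamma>: "\<gamma> \<in> X \<rightarrow> carrier A"
    "\<forall>x\<in>X. \<forall>y\<in>X. q' (x, y) = q (x, y) \<oplus> \<gamma> (x \<triangleright> y) \<ominus> \<gamma> y"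
    by (auto simp: rack_cohomologous_def)
  have \<gamma>c: "\<gamma> x \<in> carrier A" if "x \<in> X" for x using \<gamma>(1) that by blast
  define b where "b = (\<lambda>i\<in>X \<times> X. q' i \<oplus> (\<lambda>i\<in>X \<times> X. \<ominus> q i) i)"
  have bZ: "b \<in> rack_Z2 X (\<triangleright>) A"
    unfolding b_def by (rule rack_Z2_add[OF q' rack_Z2_uminus[OF q]])
  have "b (x, y) = \<gamma> (x \<triangleright> y) \<ominus> \<gamma> y" if xy: "x \<in> X" "y \<in> X" for x y
    using xy \<gamma>(2) rack_Z2_closed[OF q xy] \<gamma>c[of y] \<gamma>c[of "x \<triangleright> y"] closed[OF xy]
    by (simp add: b_def A.minus_eq A.a_ac A.r_neg A.r_neg1 A.r_neg2)
  then have "b \<in> rack_B2" using bZ \<gamma>(1) by (auto simp: rack_B2_iff)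
  moreover have "q' = (\<lambda>i\<in>X \<times> X. b i \<oplus> q i)"
  proof (rule extensionalityI)
    show "q' \<in> extensional (X \<times> X)" using q' by (auto simp: rack_Z2_def PiE_def)
    show "q' i = (\<lambda>i\<in>X \<times> X. b i \<oplus> q i) i" if "i \<in> X \<times> X" for i
      using that rack_Z2_closed[OF q] rack_Z2_closed[OF q']
      by (auto simp: b_def A.a_assoc A.l_neg)
  qed simp
  ultimately show "q' \<in> rack_B2 #>\<^bsub>rack_cocycle_group X (\<triangleright>) A\<^esub> q"
    by (auto simp: r_coset_def rack_cocycle_group_simps)
next
  fix q' assume "q' \<in> rack_B2 #>\<^bsub>rack_cocycle_group X (\<triangleright>) A\<^esub> q"
  then obtain b where b: "b \<in> rack_B2" and q': "q' = (\<lambda>i\<in>X \<times> X. b i \<oplus> q i)"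
    by (auto simp: r_coset_def rack_cocycle_group_simps)
  obtain \<gamma> where bZ: "b \<in> rack_Z2 X (\<triangleright>) A" and \<gamma>: "\<gamma> \<in> X \<rightarrow> carrier A"
    "\<forall>x\<in>X. \<forall>y\<in>X. b (x, y) = \<gamma> (x \<triangleright> y) \<ominus> \<gamma> y"
    using b unfolding rack_B2_iff by blast
  have \<gamma>c: "\<gamma> x \<in> carrier A" if "x \<in> X" for x using \<gamma>(1) that by blast
  have "q' (x, y) = q (x, y) \<oplus> \<gamma> (x \<triangleright> y) \<ominus> \<gamma> y" if xy: "x \<in> X" "y \<in> X" for x y
    using xy \<gamma>(2) rack_Z2_closed[OF q xy] \<gamma>c[of y] \<gamma>c[of "x \<triangleright> y"] closed[OF xy]
    by (simp add: q' A.minus_eq A.a_ac)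
  then show "q' \<in> rack_cohomologous X (\<triangleright>) A `` {q}"
    using q rack_Z2_add[OF bZ q] \<gamma>(1) by (auto simp: rack_cohomologous_def q')
qed

theorem rack_H2_eq_Mod: "rack_H2 X (\<triangleright>) A = rack_cocycle_group X (\<triangleright>) A Mod rack_B2"
proof -
  have "rack_Z2 X (\<triangleright>) A // rack_cohomologous X (\<triangleright>) A
      = rcosets\<^bsub>rack_cocycle_group X (\<triangleright>) A\<^esub> rack_B2"
    by (auto simp: quotient_def RCOSETS_def rack_cohomologous_coset rack_cocycle_group_simps)
  then show ?thesis
    by (simp add: rack_H2_def FactGroup_def rack_cocycle_group_simps flip: rack_B2_def)
qed

theorem comm_group_rack_H2: "comm_group (rack_H2 X (\<triangleright>) A)"
  unfolding rack_H2_eq_Mod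
  by (rule comm_group.abelian_FactGroup[OF comm_group_rack_cocycle_group subgroup_rack_B2])

end

end

theory Submission
  imports Defs
begin

text \<open>A rack 2-cocycle \<open>q\<close> is the same thing as an action of the enveloping group on \<open>X \<times> A\<close> that
  commutes with translations in \<open>A\<close> and lifts the action on \<open>X\<close>: a generator \<open>x\<close> sends \<open>(y, a)\<close> to
  \<open>(x \<triangleright> y, a + q(x, y))\<close>, and the cocycle identity for \<open>q\<close> is exactly the defining relation
  \<open>xy = (x \<triangleright> y)x\<close>. The displacement of the second coordinate is then a function \<open>V(g, y)\<close>
  with \<open>V(gh, y) = V(g, h \<triangleright> y) + V(h, y)\<close> and \<open>V(x, y) = q(x, y)\<close>; this is
  \<open>rack_cocycle_extends\<close>.

  On the stabilizer of \<open>x\<^sub>0\<close> the map \<open>n \<mapsto> V(n, x\<^sub>0)\<close> is a homomorphism, and its restriction to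
  \<open>N\<^sub>0\<close> is the \<open>g\<close> of the theorem. The element \<open>n = x\<sigma>\<^sub>yx\<^sub>0\<^sup>-\<^sup>1\<close> lies in \<open>N\<^sub>X\<close> because
  \<open>x\<close> is the conjugate \<open>\<sigma>\<^sub>xx\<^sub>0\<sigma>\<^sub>x\<^sup>-\<^sup>1\<close> of \<open>x\<^sub>0\<close> (\<open>env_gen_twisted_conj_in_comm\<close>). In a quandle \<open>x\<^sub>0\<close>
  fixes the point \<open>x\<^sub>0\<close>, so \<open>n\<close> moves the point \<open>x\<^sub>0\<close> to \<open>x \<triangleright> y\<close>, and its coset is represented by
  \<open>\<sigma>\<^sub>x\<^sub>\<triangleright>\<^sub>y\<close> (\<open>coset_rep_twisted_conj\<close>). Hence \<open>c(n) = \<sigma>\<^sub>x\<^sub>\<triangleright>\<^sub>y\<^sup>-\<^sup>1x\<sigma>\<^sub>yx\<^sub>0\<^sup>-\<^sup>1\<close>, and expanding \<open>V\<close> of this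
  product at \<open>x\<^sub>0\<close> gives \<open>-V(\<sigma>\<^sub>x\<^sub>\<triangleright>\<^sub>y, x\<^sub>0) + q(x, y) + V(\<sigma>\<^sub>y, x\<^sub>0) - q(x\<^sub>0, x\<^sub>0)\<close>. Therefore, with
  \<open>a = q(x\<^sub>0, x\<^sub>0)\<close>, the cocycle in the theorem differs from \<open>q\<close> by the coboundary of
  \<open>\<gamma>(y) = -V(\<sigma>\<^sub>y, x\<^sub>0)\<close>.\<close>

section \<open>Generators of the enveloping group and their conjugates\<close>

context rack
begin

text \<open>The enveloping group is generated by the elements of \<open>X\<close>. Properties of its elements
  are proved below by applying this to the subgroup of elements that have the property.\<close>

lemma env_group_subgroup_eq:
  assumes H: "subgroup H (env_group X (\<triangleright>))"
    and gen: "\<And>x. x \<in> X \<Longrightarrow> env_gen X (\<triangleright>) x \<in> H"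
  shows "H = carrier (env_group X (\<triangleright>))"
proof -
  let ?G = "env_group X (\<triangleright>)" and ?cls = "\<lambda>u. env_cong X (\<triangleright>) `` {u}"
  interpret G: group ?G by (rule group_env_group)
  have letter: "?cls [(x, b)] \<in> H" if x: "x \<in> X" for x b
  proof (cases b)
    case True
    then show ?thesis using gen[OF x] by (simp add: env_gen_def)
  next
    case False
    have w: "[(x, False)] \<in> env_words X" "[(x, True)] \<in> env_words X"
      using x by (simp_all add: env_words_def)
    have "([(x, False), (x, \<not> False)], []) \<in> env_cong X (\<triangleright>)"
      using x by (rule env_cong.cancel)
    then have "?cls [(x, False)] \<otimes>\<^bsub>?G\<^esub> env_gen X (\<triangleright>) x = \<one>\<^bsub>?G\<^esub>"
      unfolding env_gen_def env_one env_mult_class[OF w]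
      by (simp add: equiv_class_eq[OF equiv_env_cong])
    then have "inv\<^bsub>?G\<^esub> env_gen X (\<triangleright>) x = ?cls [(x, False)]"
      by (rule G.inv_equality) (use w x in \<open>auto simp: env_gen_carrier\<close>)
    then show ?thesis
      using subgroup.m_inv_closed[OF H gen[OF x]] False by simp
  qed
  have "u \<in> env_words X \<Longrightarrow> ?cls u \<in> H" for u
  proof (induction u)
    case Nil
    show ?case using subgroup.one_closed[OF H] by (simp add: env_one)
  next
    case (Cons l u)
    obtain x b where l: "l = (x, b)" by (cases l)
    have w: "[(x, b)] \<in> env_words X" "u \<in> env_words X" and x: "x \<in> X"
      using Cons.prems by (auto simp: l env_words_def)
    show ?case
      using subgroup.m_closed[OF H letter[OF x, of b] Cons.IH[OF w(2)]]
      by (simp add: env_mult_class[OF w] l)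
  qed
  then show ?thesis
    using subgroup.subset[OF H] by (auto elim!: env_carrier_cases)
qed

text \<open>The defining relation says that \<open>x\<close> conjugates the generator \<open>y\<close> to the generator
  \<open>x \<triangleright> y\<close>; hence every \<open>g\<close> conjugates generators the way it permutes points.\<close>

lemma env_gen_conjugate:
  assumes "g \<in> carrier (env_group X (\<triangleright>))" and "y \<in> X"
  shows "g \<otimes>\<^bsub>env_group X (\<triangleright>)\<^esub> env_gen X (\<triangleright>) y
    = env_gen X (\<triangleright>) (env_action X (\<triangleright>) g y) \<otimes>\<^bsub>env_group X (\<triangleright>)\<^esub> g"
proof -
  let ?G = "env_group X (\<triangleright>)" and ?\<iota> = "env_gen X (\<triangleright>)" and ?act = "env_action X (\<triangleright>)"
  interpret G: group ?G by (rule group_env_group)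
  interpret act: group_action ?G X ?act by (rule env_group_action)
  let ?H = "{g \<in> carrier ?G. \<forall>y\<in>X. g \<otimes>\<^bsub>?G\<^esub> ?\<iota> y = ?\<iota> (?act g y) \<otimes>\<^bsub>?G\<^esub> g}"
  have "subgroup ?H ?G"
  proof (rule G.subgroupI)
    have "?act \<one>\<^bsub>?G\<^esub> y = y" if "y \<in> X" for y
      using act.id_eq_one that by (metis restrict_apply')
    then have "\<one>\<^bsub>?G\<^esub> \<in> ?H"
      by (simp add: env_gen_carrier)
    then show "?H \<noteq> {}" by blast
  next
    fix g assume g: "g \<in> ?H"
    have "inv\<^bsub>?G\<^esub> g \<otimes>\<^bsub>?G\<^esub> ?\<iota> y = ?\<iota> (?act (inv\<^bsub>?G\<^esub> g) y) \<otimes>\<^bsub>?G\<^esub> inv\<^bsub>?G\<^esub> g"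
      if y: "y \<in> X" for y
    proof -
      have gG: "g \<in> carrier ?G" using g by blast
      obtain z where z: "z \<in> X" "?act g z = y"
        using act.surj_prop[OF gG] y by (metis imageE)
      have z': "?act (inv\<^bsub>?G\<^esub> g) y = z"
        using act.orbit_sym_aux[OF gG z] .
      have c: "g \<in> carrier ?G" "?\<iota> y \<in> carrier ?G" "?\<iota> z \<in> carrier ?G"
        using g y z by (auto simp: env_gen_carrier)
      have "g \<otimes>\<^bsub>?G\<^esub> ?\<iota> z = ?\<iota> y \<otimes>\<^bsub>?G\<^esub> g"
        using g z by blast
      then have "?\<iota> y = g \<otimes>\<^bsub>?G\<^esub> (?\<iota> z \<otimes>\<^bsub>?G\<^esub> inv\<^bsub>?G\<^esub> g)"
        using c by (simp add: G.inv_solve_right flip: G.m_assoc)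
      then show ?thesis
        using c by (simp add: z' G.inv_solve_left')
    qed
    then show "inv\<^bsub>?G\<^esub> g \<in> ?H" using g by simp
  next
    fix g h assume g: "g \<in> ?H" and h: "h \<in> ?H"
    have "g \<otimes>\<^bsub>?G\<^esub> h \<otimes>\<^bsub>?G\<^esub> ?\<iota> y = ?\<iota> (?act (g \<otimes>\<^bsub>?G\<^esub> h) y) \<otimes>\<^bsub>?G\<^esub> (g \<otimes>\<^bsub>?G\<^esub> h)"
      if y: "y \<in> X" for y
    proof -
      have hy: "?act h y \<in> X" using act.element_image h y by blast
      have ghy: "?act g (?act h y) \<in> X" using act.element_image g hy by blast
      have c: "g \<in> carrier ?G" "h \<in> carrier ?G" "?\<iota> y \<in> carrier ?G"
        "?\<iota> (?act h y) \<in> carrier ?G" "?\<iota> (?act g (?act h y)) \<in> carrier ?G"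
        using g h y hy ghy by (auto simp: env_gen_carrier)
      have gy: "g \<otimes>\<^bsub>?G\<^esub> ?\<iota> (?act h y) = ?\<iota> (?act g (?act h y)) \<otimes>\<^bsub>?G\<^esub> g"
        and hy': "h \<otimes>\<^bsub>?G\<^esub> ?\<iota> y = ?\<iota> (?act h y) \<otimes>\<^bsub>?G\<^esub> h"
        using g h y hy by blast+
      have "g \<otimes>\<^bsub>?G\<^esub> h \<otimes>\<^bsub>?G\<^esub> ?\<iota> y = (g \<otimes>\<^bsub>?G\<^esub> ?\<iota> (?act h y)) \<otimes>\<^bsub>?G\<^esub> h"
        using c by (simp add: G.m_assoc hy')
      also have "\<dots> = ?\<iota> (?act g (?act h y)) \<otimes>\<^bsub>?G\<^esub> (g \<otimes>\<^bsub>?G\<^esub> h)"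
        using c by (simp only: gy G.m_assoc)
      finally show ?thesis
        using act.composition_rule[of y g h] g h y by simp
    qed
    then show "g \<otimes>\<^bsub>?G\<^esub> h \<in> ?H" using g h by simp
  qed auto
  then have "?H = carrier ?G"
    by (rule env_group_subgroup_eq) (simp add: env_gen_carrier env_action_gen env_gen_relation)
  then show ?thesis using assms by blast
qed

text \<open>If \<open>s\<close> moves \<open>x\<^sub>0\<close> to \<open>x\<close>, then \<open>x = sx\<^sub>0s\<^sup>-\<^sup>1\<close> in the enveloping group, so \<open>xx\<^sub>0\<^sup>-\<^sup>1\<close> is a
  commutator; the rest is normality of the commutator subgroup.\<close>

lemma env_gen_twisted_conj_in_comm:
  assumes s: "s \<in> carrier (env_group X (\<triangleright>))" "env_action X (\<triangleright>) s x0 = x" and x0: "x0 \<in> X"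
    and n: "n \<in> env_comm X (\<triangleright>)"
  shows "env_gen X (\<triangleright>) x \<otimes>\<^bsub>env_group X (\<triangleright>)\<^esub> n \<otimes>\<^bsub>env_group X (\<triangleright>)\<^esub> inv\<^bsub>env_group X (\<triangleright>)\<^esub> env_gen X (\<triangleright>) x0
    \<in> env_comm X (\<triangleright>)"
proof -
  let ?G = "env_group X (\<triangleright>)" and ?\<iota> = "env_gen X (\<triangleright>)" and ?N = "env_comm X (\<triangleright>)"
  interpret G: group ?G by (rule group_env_group)
  interpret act: group_action ?G X "env_action X (\<triangleright>)" by (rule env_group_action)
  have x: "x \<in> X" using act.element_image s x0 by blast
  have nG: "n \<in> carrier ?G" using subgroup.mem_carrier[OF subgroup_env_comm n] .
  have c: "?\<iota> x \<in> carrier ?G" "?\<iota> x0 \<in> carrier ?G" using x x0 by (auto simp: env_gen_carrier)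
  have "s \<otimes>\<^bsub>?G\<^esub> ?\<iota> x0 = ?\<iota> x \<otimes>\<^bsub>?G\<^esub> s"
    using env_gen_conjugate[OF s(1) x0] s(2) by simp
  then have x_eq: "?\<iota> x = s \<otimes>\<^bsub>?G\<^esub> ?\<iota> x0 \<otimes>\<^bsub>?G\<^esub> inv\<^bsub>?G\<^esub> s"
    using c s by (simp add: G.inv_solve_right)
  have "s \<otimes>\<^bsub>?G\<^esub> ?\<iota> x0 \<otimes>\<^bsub>?G\<^esub> inv\<^bsub>?G\<^esub> s \<otimes>\<^bsub>?G\<^esub> inv\<^bsub>?G\<^esub> ?\<iota> x0 \<in> ?N"
    unfolding env_comm_def derived_def by (rule generate.incl) (use c s in blast)
  then have 1: "?\<iota> x \<otimes>\<^bsub>?G\<^esub> inv\<^bsub>?G\<^esub> ?\<iota> x0 \<in> ?N"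
    using x_eq by simp
  have "?N \<lhd> ?G"
    unfolding env_comm_def by (rule G.derived_is_normal[OF G.normal_self])
  then have 2: "?\<iota> x0 \<otimes>\<^bsub>?G\<^esub> n \<otimes>\<^bsub>?G\<^esub> inv\<^bsub>?G\<^esub> ?\<iota> x0 \<in> ?N"
    using normal.inv_op_closed2[OF _ c(2) n] by simp
  have "?\<iota> x \<otimes>\<^bsub>?G\<^esub> n \<otimes>\<^bsub>?G\<^esub> inv\<^bsub>?G\<^esub> ?\<iota> x0
      = ?\<iota> x \<otimes>\<^bsub>?G\<^esub> inv\<^bsub>?G\<^esub> ?\<iota> x0 \<otimes>\<^bsub>?G\<^esub> (?\<iota> x0 \<otimes>\<^bsub>?G\<^esub> n \<otimes>\<^bsub>?G\<^esub> inv\<^bsub>?G\<^esub> ?\<iota> x0)"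
    using c nG by (simp add: G.m_assoc G.inv_solve_left)
  then show ?thesis
    using subgroup.m_closed[OF subgroup_env_comm 1 2] by simp
qed

end

section \<open>Extending a rack cocycle to the enveloping group\<close>

context rack_coefficients
begin

definition twisted_perm :: "('a \<times> 'a \<Rightarrow> 'b) \<Rightarrow> 'a \<Rightarrow> 'a \<times> 'b \<Rightarrow> 'a \<times> 'b" where
  "twisted_perm q x = (\<lambda>(y, a)\<in>X \<times> carrier A. (x \<triangleright> y, a \<oplus> q (x, y)))"

lemma twisted_perm_Bij:
  assumes q: "q \<in> rack_Z2 X (\<triangleright>) A" and x: "x \<in> X"
  shows "twisted_perm q x \<in> carrier (BijGroup (X \<times> carrier A))"
proof -
  note qc = rack_Z2_closed[OF q]
  have "inj_on (twisted_perm q x) (X \<times> carrier A)"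
  proof (rule inj_onI, clarify)
    fix y a z b
    assume y: "y \<in> X" "a \<in> carrier A" and z: "z \<in> X" "b \<in> carrier A"
      and eq: "twisted_perm q x (y, a) = twisted_perm q x (z, b)"
    have "y = z"
      using eq y z bij_betw_imp_inj_on[OF bij[OF x]] by (auto simp: twisted_perm_def inj_on_def)
    then show "y = z \<and> a = b"
      using eq y z qc[OF x, of z] by (simp add: twisted_perm_def)
  qed
  moreover have "p \<in> twisted_perm q x ` (X \<times> carrier A)" if p: "p \<in> X \<times> carrier A" for p
  proof -
    obtain y b where p': "p = (y, b)" "y \<in> X" "b \<in> carrier A" using p by auto
    obtain z where z: "z \<in> X" "x \<triangleright> z = y"
      using bij_betw_imp_surj_on[OF bij[OF x]] p'(2) by (metis imageE)
    have "twisted_perm q x (z, b \<ominus> q (x, z)) = p"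
      using p' z qc[OF x z(1)] by (simp add: twisted_perm_def A.minus_eq A.a_assoc A.l_neg)
    then show ?thesis
      using p' z qc[OF x z(1)] by (metis A.minus_closed SigmaI imageI)
  qed
  moreover have "twisted_perm q x ` (X \<times> carrier A) \<subseteq> X \<times> carrier A"
    using qc x by (auto simp: twisted_perm_def closed)
  ultimately have "bij_betw (twisted_perm q x) (X \<times> carrier A) (X \<times> carrier A)"
    unfolding bij_betw_def by blast
  then show ?thesis
    by (simp add: BijGroup_def Bij_def twisted_perm_def)
qed

text \<open>This is where the cocycle identity is used: the two sides move the second coordinate of
  \<open>(z, a)\<close> by the two sides of that identity.\<close>

lemma twisted_perm_relation:
  assumes q: "q \<in> rack_Z2 X (\<triangleright>) A" and xy: "x \<in> X" "y \<in> X"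
  shows "twisted_perm q x \<otimes>\<^bsub>BijGroup (X \<times> carrier A)\<^esub> twisted_perm q y
       = twisted_perm q (x \<triangleright> y) \<otimes>\<^bsub>BijGroup (X \<times> carrier A)\<^esub> twisted_perm q x"
proof -
  note qc = rack_Z2_closed[OF q]
  have "twisted_perm q x (twisted_perm q y (z, a))
      = twisted_perm q (x \<triangleright> y) (twisted_perm q x (z, a))"
    if z: "z \<in> X" "a \<in> carrier A" for z a
  proof -
    have "q (y, z) \<oplus> q (x, y \<triangleright> z) = q (x, z) \<oplus> q (x \<triangleright> y, x \<triangleright> z)"
      using q xy z(1) qc by (simp add: rack_Z2_def A.a_comm closed)
    then show ?thesis
      using xy z qc by (simp add: twisted_perm_def closed A.a_assoc self_distrib[OF xy z(1)])
  qed
  moreover have "twisted_perm q v \<in> Bij (X \<times> carrier A)" if "v \<in> X" for v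
    using twisted_perm_Bij[OF q that] by (simp add: BijGroup_def)
  ultimately show ?thesis
    using xy by (auto simp: BijGroup_def compose_def closed intro!: restrict_ext)
qed

text \<open>\<open>V g y\<close> is the amount by which \<open>g\<close> moves the \<open>A\<close>-coordinate over the point \<open>y\<close>. That this
  amount is the same along the whole fibre over \<open>y\<close> holds for generators and is inherited by
  products and inverses; multiplicativity of the action then reads as the crossed rule for \<open>V\<close>.\<close>

theorem rack_cocycle_extends:
  assumes q: "q \<in> rack_Z2 X (\<triangleright>) A"
  obtains V where
    "\<And>g y. \<lbrakk>g \<in> carrier (env_group X (\<triangleright>)); y \<in> X\<rbrakk> \<Longrightarrow> V g y \<in> carrier A"
    "\<And>g h y. \<lbrakk>g \<in> carrier (env_group X (\<triangleright>)); h \<in> carrier (env_group X (\<triangleright>)); y \<in> X\<rbrakk>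
      \<Longrightarrow> V (g \<otimes>\<^bsub>env_group X (\<triangleright>)\<^esub> h) y = V g (env_action X (\<triangleright>) h y) \<oplus> V h y"
    "\<And>x y. \<lbrakk>x \<in> X; y \<in> X\<rbrakk> \<Longrightarrow> V (env_gen X (\<triangleright>) x) y = q (x, y)"
proof -
  let ?G = "env_group X (\<triangleright>)" and ?\<iota> = "env_gen X (\<triangleright>)" and ?act = "env_action X (\<triangleright>)"
  let ?E = "X \<times> carrier A"
  define T where "T = env_lift (BijGroup ?E) (twisted_perm q)"
  note qc = rack_Z2_closed[OF q]
  interpret G: group ?G by (rule group_env_group)
  interpret act: group_action ?G X ?act by (rule env_group_action)
  have "group_action ?G ?E T"
    unfolding group_action_def group_hom_def group_hom_axioms_def T_def
    by (intro conjI group_env_group group_BijGroup env_lift_hom funcsetI twisted_perm_Bij[OF q]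
        twisted_perm_relation[OF q])
  then interpret T: group_action ?G ?E T .
  have T_gen: "T (?\<iota> x) (y, a) = (x \<triangleright> y, a \<oplus> q (x, y))"
    if "x \<in> X" "y \<in> X" "a \<in> carrier A" for x y a
  proof -
    have "T (?\<iota> x) = twisted_perm q x"
      unfolding T_def
      by (intro env_lift_gen group_BijGroup funcsetI twisted_perm_Bij[OF q]
          twisted_perm_relation[OF q] that)
    then show ?thesis using that by (simp add: twisted_perm_def)
  qed
  \<comment> \<open>The elements that translate every fibre; these commute with the translations in \<open>A\<close>.\<close>
  let ?H = "{g \<in> carrier ?G. \<forall>y\<in>X. \<exists>v\<in>carrier A. \<forall>a\<in>carrier A. T g (y, a) = (?act g y, a \<oplus> v)}"
  have "subgroup ?H ?G"
  proof (rule G.subgroupI)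
    have "?act \<one>\<^bsub>?G\<^esub> y = y" if "y \<in> X" for y
      using act.id_eq_one that by (metis restrict_apply')
    moreover have "T \<one>\<^bsub>?G\<^esub> p = p" if "p \<in> ?E" for p
      using T.id_eq_one that by (metis restrict_apply')
    ultimately have "\<one>\<^bsub>?G\<^esub> \<in> ?H"
      by (auto intro!: bexI[of _ \<zero>])
    then show "?H \<noteq> {}" by blast
  next
    fix g assume g: "g \<in> ?H"
    have "\<exists>v\<in>carrier A. \<forall>a\<in>carrier A. T (inv\<^bsub>?G\<^esub> g) (y, a) = (?act (inv\<^bsub>?G\<^esub> g) y, a \<oplus> v)"
      if y: "y \<in> X" for y
    proof -
      have gG: "g \<in> carrier ?G" using g by blast
      obtain z where z: "z \<in> X" "?act g z = y"
        using act.surj_prop[OF gG] y by (metis imageE)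
      have z': "?act (inv\<^bsub>?G\<^esub> g) y = z"
        using act.orbit_sym_aux[OF gG z] .
      obtain v where v: "v \<in> carrier A" "\<forall>a\<in>carrier A. T g (z, a) = (y, a \<oplus> v)"
        using g z by blast
      have "T (inv\<^bsub>?G\<^esub> g) (y, a) = (z, a \<oplus> \<ominus> v)" if a: "a \<in> carrier A" for a
      proof (rule T.orbit_sym_aux)
        show "T g (z, a \<oplus> \<ominus> v) = (y, a)"
          using v a by (simp add: A.a_assoc A.l_neg)
      qed (use g z v a in auto)
      then show ?thesis using v(1) z' by blast
    qed
    then show "inv\<^bsub>?G\<^esub> g \<in> ?H" using g by simp
  next
    fix g h assume g: "g \<in> ?H" and h: "h \<in> ?H"
    have "\<exists>v\<in>carrier A. \<forall>a\<in>carrier A. T (g \<otimes>\<^bsub>?G\<^esub> h) (y, a) = (?act (g \<otimes>\<^bsub>?G\<^esub> h) y, a \<oplus> v)"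
      if y: "y \<in> X" for y
    proof -
      have hy: "?act h y \<in> X" using act.element_image h y by blast
      obtain v where v: "v \<in> carrier A" "\<forall>a\<in>carrier A. T h (y, a) = (?act h y, a \<oplus> v)"
        using h y by blast
      obtain w where w: "w \<in> carrier A"
        "\<forall>a\<in>carrier A. T g (?act h y, a) = (?act g (?act h y), a \<oplus> w)"
        using g hy by blast
      have "T (g \<otimes>\<^bsub>?G\<^esub> h) (y, a) = (?act (g \<otimes>\<^bsub>?G\<^esub> h) y, a \<oplus> (v \<oplus> w))"
        if a: "a \<in> carrier A" for a
        using T.composition_rule[of "(y, a)" g h] act.composition_rule[of y g h] g h y a v w
        by (simp add: A.a_assoc)
      then show ?thesis using v(1) w(1) by blast
    qed
    then show "g \<otimes>\<^bsub>?G\<^esub> h \<in> ?H" using g h by simp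
  qed auto
  then have H: "?H = carrier ?G"
    by (rule env_group_subgroup_eq) (use qc in \<open>auto simp: env_gen_carrier env_action_gen T_gen\<close>)
  define V where "V g y = snd (T g (y, \<zero>))" for g y
  have V: "V g y \<in> carrier A \<and> (\<forall>a\<in>carrier A. T g (y, a) = (?act g y, a \<oplus> V g y))"
    if g: "g \<in> carrier ?G" and y: "y \<in> X" for g y
  proof -
    obtain v where v: "v \<in> carrier A" "\<forall>a\<in>carrier A. T g (y, a) = (?act g y, a \<oplus> v)"
      using g y H by blast
    then have "V g y = v" by (simp add: V_def)
    with v show ?thesis by simp
  qed
  show thesis
  proof (rule that[of V])
    fix g h y assume g: "g \<in> carrier ?G" and h: "h \<in> carrier ?G" and y: "y \<in> X"
    have hy: "?act h y \<in> X" using act.element_image h y by blast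
    have "T (g \<otimes>\<^bsub>?G\<^esub> h) (y, \<zero>) = (?act g (?act h y), V h y \<oplus> V g (?act h y))"
      using T.composition_rule[of "(y, \<zero>)" g h] V[OF g hy] V[OF h y] g h y by simp
    then show "V (g \<otimes>\<^bsub>?G\<^esub> h) y = V g (?act h y) \<oplus> V h y"
      using V[OF g hy] V[OF h y] by (simp add: V_def[of "g \<otimes>\<^bsub>?G\<^esub> h"] A.a_comm)
  qed (use V in blast, use qc in \<open>simp add: V_def T_gen\<close>)
qed

text \<open>The coboundary \<open>\<gamma>(x \<triangleright> y) - \<gamma>(y)\<close> is a cocycle for every \<open>\<gamma>\<close>: both sides of the
  cocycle identity telescope to \<open>\<gamma>(x \<triangleright> (y \<triangleright> z)) - \<gamma>(z)\<close>.\<close>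

lemma rack_cohomologousI:
  assumes q: "q \<in> rack_Z2 X (\<triangleright>) A" and \<gamma>: "\<gamma> \<in> X \<rightarrow> carrier A"
    and q': "q' \<in> extensional (X \<times> X)"
    and eq: "\<And>x y. \<lbrakk>x \<in> X; y \<in> X\<rbrakk> \<Longrightarrow> q' (x, y) = q (x, y) \<oplus> \<gamma> (x \<triangleright> y) \<ominus> \<gamma> y"
  shows "(q, q') \<in> rack_cohomologous X (\<triangleright>) A"
proof -
  have \<gamma>c: "\<gamma> x \<in> carrier A" if "x \<in> X" for x using \<gamma> that by blast
  let ?b = "\<lambda>(x, y)\<in>X \<times> X. \<gamma> (x \<triangleright> y) \<ominus> \<gamma> y"
  have "?b (x \<triangleright> y, x \<triangleright> z) \<oplus> ?b (x, z) = ?b (x, y \<triangleright> z) \<oplus> ?b (y, z)"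
    if xyz: "x \<in> X" "y \<in> X" "z \<in> X" for x y z
  proof -
    have telescope: "(a \<ominus> b) \<oplus> (b \<ominus> c) = a \<ominus> c"
      if "a \<in> carrier A" "b \<in> carrier A" "c \<in> carrier A" for a b c
      using that by (simp add: A.minus_eq A.a_assoc A.r_neg1)
    show ?thesis
      using xyz \<gamma>c by (simp add: closed telescope self_distrib[OF xyz])
  qed
  then have b: "?b \<in> rack_Z2 X (\<triangleright>) A"
    using \<gamma>c by (auto simp: rack_Z2_def closed)
  have "q' = (\<lambda>i\<in>X \<times> X. q i \<oplus> ?b i)"
    by (rule extensionalityI[OF q'])
      (use eq \<gamma>c rack_Z2_closed[OF q] in \<open>auto simp: A.minus_eq A.a_assoc closed\<close>)
  then have "q' \<in> rack_Z2 X (\<triangleright>) A"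
    using rack_Z2_add[OF q b] by simp
  then show ?thesis
    using q \<gamma> eq by (auto simp: rack_cohomologous_def)
qed

end

section \<open>Coset representatives in a good decomposition\<close>

lemma (in rack) point_rep:
  assumes good: "good_decomposition X (\<triangleright>) x0 k \<sigma>" and x0: "x0 \<in> X" and z: "z \<in> X"
  shows "point_rep X (\<triangleright>) x0 k \<sigma> z \<in> env_comm X (\<triangleright>)"
    and "env_action X (\<triangleright>) (point_rep X (\<triangleright>) x0 k \<sigma> z) x0 = z"
proof -
  obtain j where j: "j \<le> k" "env_action X (\<triangleright>) (\<sigma> j) x0 = z"
    using good z unfolding good_decomposition_def Let_def by blast
  then have "point_rep X (\<triangleright>) x0 k \<sigma> z = \<sigma> j"
    by (rule point_rep_eqI[OF good x0])
  then show "point_rep X (\<triangleright>) x0 k \<sigma> z \<in> env_comm X (\<triangleright>)"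
    and "env_action X (\<triangleright>) (point_rep X (\<triangleright>) x0 k \<sigma> z) x0 = z"
    using good j unfolding good_decomposition_def Let_def by auto
qed

text \<open>The representative of a coset of \<open>N\<^sub>0\<close> is determined by where the coset moves \<open>x\<^sub>0\<close>. By
  idempotence \<open>x\<^sub>0\<close> fixes the point \<open>x\<^sub>0\<close>, so \<open>x\<sigma>\<^sub>yx\<^sub>0\<^sup>-\<^sup>1\<close> moves it to \<open>x \<triangleright> y\<close>.\<close>

lemma (in quandle) coset_rep_twisted_conj:
  fixes x0 k \<sigma>
  defines "G \<equiv> env_group X (\<triangleright>)" and "\<iota> \<equiv> env_gen X (\<triangleright>)" and "s \<equiv> point_rep X (\<triangleright>) x0 k \<sigma>"
  assumes good: "good_decomposition X (\<triangleright>) x0 k \<sigma>" and x0: "x0 \<in> X" and x: "x \<in> X" and y: "y \<in> X"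
  shows "coset_rep X (\<triangleright>) x0 k \<sigma> (\<iota> x \<otimes>\<^bsub>G\<^esub> s y \<otimes>\<^bsub>G\<^esub> inv\<^bsub>G\<^esub> \<iota> x0) = s (x \<triangleright> y)"
proof -
  let ?act = "env_action X (\<triangleright>)"
  interpret G: group G unfolding G_def by (rule group_env_group)
  interpret act: group_action G X ?act unfolding G_def by (rule env_group_action)
  define n where "n = \<iota> x \<otimes>\<^bsub>G\<^esub> s y \<otimes>\<^bsub>G\<^esub> inv\<^bsub>G\<^esub> \<iota> x0"
  have s: "s z \<in> env_comm X (\<triangleright>)" "s z \<in> carrier G" "?act (s z) x0 = z" if "z \<in> X" for z
    using point_rep[OF good x0 that] subgroup.mem_carrier[OF subgroup_env_comm]
    by (auto simp: s_def G_def)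
  have \<iota>: "\<iota> z \<in> carrier G" if "z \<in> X" for z
    using that by (simp add: \<iota>_def G_def env_gen_carrier)
  have "?act (\<iota> x0) x0 = x0"
    using x0 by (simp add: \<iota>_def env_action_gen idem)
  then have fix0: "?act (inv\<^bsub>G\<^esub> \<iota> x0) x0 = x0"
    using act.orbit_sym_aux[OF \<iota>[OF x0] x0] by simp
  have "?act n x0 = ?act (\<iota> x) (?act (s y) (?act (inv\<^bsub>G\<^esub> \<iota> x0) x0))"
    unfolding n_def using x y x0 \<iota> s fix0 by (simp add: act.composition_rule)
  then have n_act: "?act n x0 = x \<triangleright> y"
    using fix0 s x y by (simp add: \<iota>_def env_action_gen)
  have "n \<in> env_comm X (\<triangleright>)"
    unfolding n_def \<iota>_def G_def
    by (rule env_gen_twisted_conj_in_comm[OF _ _ x0]) (use s x y in \<open>auto simp: G_def\<close>)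
  then obtain i where i: "i \<le> k" "n \<in> \<sigma> i <#\<^bsub>G\<^esub> env_stab X (\<triangleright>) x0"
    using good unfolding good_decomposition_def Let_def G_def by blast
  then obtain m where m: "m \<in> env_stab X (\<triangleright>) x0" "n = \<sigma> i \<otimes>\<^bsub>G\<^esub> m"
    by (auto simp: l_coset_def)
  have \<sigma>i: "\<sigma> i \<in> carrier G"
    using good i(1) subgroup.mem_carrier[OF subgroup_env_comm]
    unfolding good_decomposition_def Let_def G_def by blast
  have mG: "m \<in> carrier G"
    using m(1) subgroup.mem_carrier[OF subgroup_env_stab[OF x0]] by (simp add: G_def)
  have "?act m x0 = x0"
    using m(1) by (simp add: env_stab_def stabilizer_def)
  then have "?act (\<sigma> i) x0 = x \<triangleright> y"
    using n_act act.composition_rule[OF x0 \<sigma>i mG] m(2) by simp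
  then have "s (x \<triangleright> y) = \<sigma> i"
    unfolding s_def by (rule point_rep_eqI[OF good x0 i(1)])
  moreover have "coset_rep X (\<triangleright>) x0 k \<sigma> n = \<sigma> i"
    using coset_rep_eqI[OF good i(1)] i(2) by (simp add: G_def)
  ultimately show ?thesis by (simp add: n_def)
qed

section \<open>The representing cocycle\<close>

theorem corollary1p3:
  fixes X :: "'a set" and opr :: "'a \<Rightarrow> 'a \<Rightarrow> 'a" (infixr \<open>\<triangleright>\<close> 70)
    and x0 :: 'a
    and A :: "('b, 'm) ring_scheme" (structure)
    and k :: nat and \<sigma> :: "nat \<Rightarrow> ('a \<times> bool) list set"
    and Q :: "('a \<times> 'a \<Rightarrow> 'b) set"
  defines "G \<equiv> env_group X (\<triangleright>)"
    and "N0 \<equiv> env_stab X (\<triangleright>) x0"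
    and "\<iota> \<equiv> env_gen X (\<triangleright>)"
    and "c \<equiv> coset_part X (\<triangleright>) x0 k \<sigma>"
    and "s \<equiv> point_rep X (\<triangleright>) x0 k \<sigma>"
  assumes "quandle X (\<triangleright>)" and "finite X" and "indecomposable X (\<triangleright>)"
    and "x0 \<in> X"
    and "abelian_group A"
    and "good_decomposition X (\<triangleright>) x0 k \<sigma>"
    and "Q \<in> carrier (rack_H2 X (\<triangleright>) A)"
  shows "\<exists>a\<in>carrier A. \<exists>g\<in>hom (G\<lparr>carrier := N0\<rparr>) (add_monoid A).
    (\<lambda>(x, y)\<in>X \<times> X. a \<oplus> g (c (\<iota> x \<otimes>\<^bsub>G\<^esub> s y \<otimes>\<^bsub>G\<^esub> inv\<^bsub>G\<^esub> \<iota> x0))) \<in> Q"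
proof -
  interpret quandle X opr by fact
  interpret A: abelian_group A by fact
  interpret rack_coefficients X opr A ..
  interpret G: group G unfolding G_def by (rule group_env_group)
  let ?act = "env_action X (\<triangleright>)"
  interpret act: group_action G X ?act unfolding G_def by (rule env_group_action)
  note x0 = \<open>x0 \<in> X\<close> and good = \<open>good_decomposition X (\<triangleright>) x0 k \<sigma>\<close>
  obtain q where q: "q \<in> rack_Z2 X (\<triangleright>) A" and Q: "Q = rack_cohomologous X (\<triangleright>) A `` {q}"
    using \<open>Q \<in> carrier (rack_H2 X (\<triangleright>) A)\<close> by (auto simp: rack_H2_def elim: quotientE)
  obtain V where Vc: "\<And>g y. \<lbrakk>g \<in> carrier G; y \<in> X\<rbrakk> \<Longrightarrow> V g y \<in> carrier A"
    and V_mult: "\<And>g h y. \<lbrakk>g \<in> carrier G; h \<in> carrier G; y \<in> X\<rbrakk>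
      \<Longrightarrow> V (g \<otimes>\<^bsub>G\<^esub> h) y = V g (?act h y) \<oplus> V h y"
    and V_gen: "\<And>x y. \<lbrakk>x \<in> X; y \<in> X\<rbrakk> \<Longrightarrow> V (\<iota> x) y = q (x, y)"
    using rack_cocycle_extends[OF q] unfolding G_def \<iota>_def by metis
  have V_inv: "V (inv\<^bsub>G\<^esub> g) (?act g y) = \<ominus> V g y" if g: "g \<in> carrier G" and y: "y \<in> X" for g y
  proof -
    have gy: "?act g y \<in> X" using act.element_image g y by blast
    have "?act \<one>\<^bsub>G\<^esub> y = y" using act.id_eq_one y by (metis restrict_apply')
    then have "V \<one>\<^bsub>G\<^esub> y = V \<one>\<^bsub>G\<^esub> y \<oplus> V \<one>\<^bsub>G\<^esub> y"
      using V_mult[of "\<one>\<^bsub>G\<^esub>" "\<one>\<^bsub>G\<^esub>" y] y by simp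
    then have "V \<one>\<^bsub>G\<^esub> y = \<zero>" using Vc[of "\<one>\<^bsub>G\<^esub>" y] y by simp
    then have "V (inv\<^bsub>G\<^esub> g) (?act g y) \<oplus> V g y = \<zero>"
      using V_mult[of "inv\<^bsub>G\<^esub> g" g y] g y by simp
    then show ?thesis
      using Vc[of g y] Vc[of "inv\<^bsub>G\<^esub> g" "?act g y"] g y gy by (simp add: A.minus_equality)
  qed
  have s: "s z \<in> carrier G" "?act (s z) x0 = z" if "z \<in> X" for z
    using point_rep[OF good x0 that] subgroup.mem_carrier[OF subgroup_env_comm]
    by (auto simp: s_def G_def)
  have \<iota>: "\<iota> z \<in> carrier G" if "z \<in> X" for z
    using that by (simp add: \<iota>_def G_def env_gen_carrier)
  have \<iota>_act: "?act (\<iota> x) y = x \<triangleright> y" if "x \<in> X" "y \<in> X" for x y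
    using that by (simp add: \<iota>_def env_action_gen)
  have N0: "n \<in> carrier G" "?act n x0 = x0" if "n \<in> N0" for n
    using that subgroup.mem_carrier[OF subgroup_env_stab[OF x0]]
    by (auto simp: N0_def G_def env_stab_def stabilizer_def)
  let ?a = "q (x0, x0)" and ?g = "\<lambda>n. V n x0" and ?\<gamma> = "\<lambda>y. \<ominus> V (s y) x0"
  let ?q' = "\<lambda>(x, y)\<in>X \<times> X. ?a \<oplus> ?g (c (\<iota> x \<otimes>\<^bsub>G\<^esub> s y \<otimes>\<^bsub>G\<^esub> inv\<^bsub>G\<^esub> \<iota> x0))"
  have a: "?a \<in> carrier A" using rack_Z2_closed[OF q x0 x0] .
  have g: "?g \<in> hom (G\<lparr>carrier := N0\<rparr>) (add_monoid A)"
    by (rule homI) (use x0 N0 Vc V_mult in auto)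
  have eq: "?q' (x, y) = q (x, y) \<oplus> ?\<gamma> (x \<triangleright> y) \<ominus> ?\<gamma> y" if x: "x \<in> X" and y: "y \<in> X" for x y
  proof -
    have xy: "x \<triangleright> y \<in> X" using x y by (rule closed)
    have fix0: "?act (inv\<^bsub>G\<^esub> \<iota> x0) x0 = x0"
      using act.orbit_sym_aux[OF \<iota>[OF x0] x0] \<iota>_act[OF x0 x0] idem[OF x0] by simp
    have "V (inv\<^bsub>G\<^esub> \<iota> x0) x0 = \<ominus> ?a"
      using V_inv[OF \<iota>[OF x0] x0] \<iota>_act[OF x0 x0] idem[OF x0] V_gen[OF x0 x0] by simp
    moreover have "V (inv\<^bsub>G\<^esub> s (x \<triangleright> y)) (x \<triangleright> y) = \<ominus> V (s (x \<triangleright> y)) x0"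
      using V_inv[OF s(1)[OF xy] x0] s(2)[OF xy] by simp
    ultimately have "?g (inv\<^bsub>G\<^esub> s (x \<triangleright> y) \<otimes>\<^bsub>G\<^esub> (\<iota> x \<otimes>\<^bsub>G\<^esub> s y \<otimes>\<^bsub>G\<^esub> inv\<^bsub>G\<^esub> \<iota> x0))
        = \<ominus> V (s (x \<triangleright> y)) x0 \<oplus> (q (x, y) \<oplus> V (s y) x0 \<oplus> \<ominus> ?a)"
      using x y x0 xy \<iota> s fix0 by (simp add: V_mult V_gen \<iota>_act act.composition_rule)
    moreover have "c (\<iota> x \<otimes>\<^bsub>G\<^esub> s y \<otimes>\<^bsub>G\<^esub> inv\<^bsub>G\<^esub> \<iota> x0)
        = inv\<^bsub>G\<^esub> s (x \<triangleright> y) \<otimes>\<^bsub>G\<^esub> (\<iota> x \<otimes>\<^bsub>G\<^esub> s y \<otimes>\<^bsub>G\<^esub> inv\<^bsub>G\<^esub> \<iota> x0)"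
      using coset_rep_twisted_conj[OF good x0 x y]
      by (simp add: c_def coset_part_def G_def s_def \<iota>_def)
    moreover have "?a \<oplus> (v \<oplus> (p \<oplus> w \<oplus> \<ominus> ?a)) = p \<oplus> v \<ominus> \<ominus> w"
      if "p \<in> carrier A" "v \<in> carrier A" "w \<in> carrier A" for p v w
    proof -
      have "?a \<oplus> (v \<oplus> (p \<oplus> w \<oplus> \<ominus> ?a)) = (?a \<oplus> \<ominus> ?a) \<oplus> (p \<oplus> v \<oplus> w)"
        using that a by (simp only: A.a_ac A.add.m_closed A.a_inv_closed)
      then show ?thesis
        using that a by (simp add: A.r_neg A.minus_eq)
    qed
    ultimately show ?thesis
      using x y rack_Z2_closed[OF q x y] Vc[OF s(1)[OF y] x0] Vc[OF s(1)[OF xy] x0]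
      by simp
  qed
  have "(q, ?q') \<in> rack_cohomologous X (\<triangleright>) A"
    by (rule rack_cohomologousI[OF q, of ?\<gamma>]) (use Vc s x0 eq in auto)
  then have "?q' \<in> Q"
    by (simp add: Q)
  then show ?thesis
    by (intro bexI[OF _ a] bexI[OF _ g])
qed

end
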